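(* Let $G=(V,E)$ be an infinite, locally finite, connected graph and let $\lambda_0(\Delta)$ be the bottom of the spectrum of its Laplacian. For every real $\lambda\le\lambda_0(\Delta)$ there exists a positive $\lambda$-harmonic function on $G$. For every real $\lambda>\lambda_0(\Delta)$ there is no such function.
   Context: The combinatorial Laplacian is $\Delta f(x)=\sum_{y\sim x}(f(x)-f(y))$, where $y\sim x$ means that $x,y$ are joined by an edge. A function $v:V\to\mathbf{R}$ is $\lambda$-harmonic if $\Delta v(x)=\lambda v(x)$ for all $x\in V$. Fix a vertex $x_0$, let $B_r$ be the ball of radius $r$ about $x_0$ in the graph distance, $\partial B_r$ the set of vertices of $B_r$ having a neighbor outside $B_r$, and $C(B_r,\partial B_r)$ the functions on $B_r$ vanishing on $\partial B_r$ (extended by $0$ outside). With $\langle f,f\rangle=\sum_x f(x)^2$ and $\langle df,df\rangle=\sum (f(y)-f(x))^2$, the latter sum taken over all edges $\{x,y\}$ counted once, set $$\lambda_0(\Delta_r)=\min_{f\in C(B_r,\partial B_r),\,f\not\equiv0}\frac{\langle df,df\rangle}{\langle f,f\rangle},\qquad \lambda_0(\Delta)=\lim_{r\to\infty}\lambda_0(\Delta_r).$$ Equivalently, $\lambda_0(\Delta)=\inf\frac{\langle df,df\rangle}{\langle f,f\rangle}$ over all finitely supported $f\not\equiv0$ on $V$. *)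

theory Defs
  imports "HOL-Analysis.Analysis"
begin

text \<open>A simple graph \<open>G = (V, E)\<close> has a carrier set of vertices and a set of two-element subsets
  as edges. Vertex functions are total functions on the ambient type; for arbitrary functions
  (such as harmonic ones) only the values on \<open>V\<close> matter.\<close>

definition simple_graph :: "'a set \<Rightarrow> 'a set set \<Rightarrow> bool" where
  "simple_graph V E \<longleftrightarrow> (\<forall>e\<in>E. e \<subseteq> V \<and> card e = 2)"

definition graph_adj :: "'a set set \<Rightarrow> 'a \<Rightarrow> 'a \<Rightarrow> bool" where
  "graph_adj E x y \<longleftrightarrow> {x, y} \<in> E"

definition locally_finite_graph :: "'a set \<Rightarrow> 'a set set \<Rightarrow> bool" where
  "locally_finite_graph V E \<longleftrightarrow> (\<forall>x\<in>V. finite {y. graph_adj E x y})"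

definition connected_graph :: "'a set \<Rightarrow> 'a set set \<Rightarrow> bool" where
  "connected_graph V E \<longleftrightarrow> V \<noteq> {} \<and> (\<forall>x\<in>V. \<forall>y\<in>V. (graph_adj E)\<^sup>*\<^sup>* x y)"

text \<open>The power \<open>graph_adj E ^^ n\<close> relates the end points of the walks with \<open>n\<close> edges.
  The minimum is meaningful only for vertices joined by a walk.\<close>

definition graph_dist :: "'a set set \<Rightarrow> 'a \<Rightarrow> 'a \<Rightarrow> nat" where
  "graph_dist E x y = (LEAST n. (graph_adj E ^^ n) x y)"

definition graph_ball :: "'a set \<Rightarrow> 'a set set \<Rightarrow> 'a \<Rightarrow> nat \<Rightarrow> 'a set" where
  "graph_ball V E x0 r = {x\<in>V. graph_dist E x0 x \<le> r}"

definition graph_sphere :: "'a set \<Rightarrow> 'a set set \<Rightarrow> 'a \<Rightarrow> nat \<Rightarrow> 'a set" where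
  "graph_sphere V E x0 r =
     {x \<in> graph_ball V E x0 r. \<exists>y. graph_adj E x y \<and> y \<notin> graph_ball V E x0 r}"

definition laplacian :: "'a set set \<Rightarrow> ('a \<Rightarrow> real) \<Rightarrow> 'a \<Rightarrow> real" where
  "laplacian E f x = (\<Sum>y | graph_adj E x y. f x - f y)"

definition harmonic_fn :: "'a set \<Rightarrow> 'a set set \<Rightarrow> real \<Rightarrow> ('a \<Rightarrow> real) \<Rightarrow> bool" where
  "harmonic_fn V E c v \<longleftrightarrow> (\<forall>x\<in>V. laplacian E v x = c * v x)"

definition dirichlet_functions :: "'a set \<Rightarrow> 'a set set \<Rightarrow> 'a \<Rightarrow> nat \<Rightarrow> ('a \<Rightarrow> real) set" where
  "dirichlet_functions V E x0 r =
     {f. (\<forall>x \<in> graph_sphere V E x0 r. f x = 0) \<and> (\<forall>x. x \<notin> graph_ball V E x0 r \<longrightarrow> f x = 0)}"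

definition norm_sq :: "'a set \<Rightarrow> ('a \<Rightarrow> real) \<Rightarrow> real" where
  "norm_sq V f = (\<Sum>\<^sub>\<infinity>x\<in>V. (f x)\<^sup>2)"

text \<open>The sum ranges over ordered pairs of adjacent vertices, in which every edge occurs
  exactly twice; halving it counts every edge once.\<close>

definition energy :: "'a set set \<Rightarrow> ('a \<Rightarrow> real) \<Rightarrow> real" where
  "energy E f = (\<Sum>\<^sub>\<infinity>(x, y) \<in> {(x, y). graph_adj E x y}. (f y - f x)\<^sup>2) / 2"

definition rayleigh_quotients :: "'a set \<Rightarrow> 'a set set \<Rightarrow> 'a \<Rightarrow> nat \<Rightarrow> real set" where
  "rayleigh_quotients V E x0 r =
     {energy E f / norm_sq V f | f. f \<in> dirichlet_functions V E x0 r \<and> f \<noteq> (\<lambda>x. 0)}"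

text \<open>In an infinite, connected, locally finite graph the following infimum is a minimum for
  every \<open>r \<ge> 1\<close> and the limit below exists; both facts are proved at the end of this theory.
  For \<open>r = 0\<close> the ball equals its boundary, so that no admissible function exists and the value
  is irrelevant.\<close>

definition lambda0_ball :: "'a set \<Rightarrow> 'a set set \<Rightarrow> 'a \<Rightarrow> nat \<Rightarrow> real" where
  "lambda0_ball V E x0 r = Inf (rayleigh_quotients V E x0 r)"

definition lambda0 :: "'a set \<Rightarrow> 'a set set \<Rightarrow> 'a \<Rightarrow> real" where
  "lambda0 V E x0 = lim (\<lambda>r. lambda0_ball V E x0 r)"


lemma graph_adj_sym: "graph_adj E x y \<Longrightarrow> graph_adj E y x"
  by (simp add: graph_adj_def insert_commute)

lemma graph_adj_V: "simple_graph V E \<Longrightarrow> graph_adj E x y \<Longrightarrow> x \<in> V \<and> y \<in> V"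
  by (auto simp: graph_adj_def simple_graph_def)

lemma graph_dist_walk:
  assumes "connected_graph V E" "x \<in> V" "y \<in> V"
  shows "(graph_adj E ^^ graph_dist E x y) x y"
proof -
  have "(graph_adj E)\<^sup>*\<^sup>* x y"
    using assms by (auto simp: connected_graph_def)
  then obtain n where "(graph_adj E ^^ n) x y"
    by (auto simp: rtranclp_power)
  then show ?thesis
    unfolding graph_dist_def by (rule LeastI)
qed

lemma finite_walk_ends:
  assumes "simple_graph V E" "locally_finite_graph V E" "x \<in> V"
  shows "finite {y. (graph_adj E ^^ n) x y} \<and> {y. (graph_adj E ^^ n) x y} \<subseteq> V"
proof (induction n)
  case 0
  have "{y. (graph_adj E ^^ 0) x y} = {x}" by auto
  then show ?case using assms(3) by (metis finite.emptyI finite_insert empty_subsetI insert_subset)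
next
  case (Suc n)
  have eq: "{y. (graph_adj E ^^ Suc n) x y}
      = (\<Union>z\<in>{z. (graph_adj E ^^ n) x z}. {y. graph_adj E z y})"
    by (auto simp: relcompp_apply)
  have "finite {y. graph_adj E z y}" if "(graph_adj E ^^ n) x z" for z
    using Suc assms(2) that unfolding locally_finite_graph_def by blast
  then have "finite {y. (graph_adj E ^^ Suc n) x y}"
    unfolding eq using Suc by blast
  moreover have "{y. (graph_adj E ^^ Suc n) x y} \<subseteq> V"
    unfolding eq using graph_adj_V[OF assms(1)] by blast
  ultimately show ?case by blast
qed

lemma finite_graph_ball:
  assumes "simple_graph V E" "locally_finite_graph V E" "connected_graph V E" "x0 \<in> V"
  shows "finite (graph_ball V E x0 r)"
proof (rule finite_subset)
  show "graph_ball V E x0 r \<subseteq> (\<Union>n\<in>{..r}. {y. (graph_adj E ^^ n) x0 y})"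
    using graph_dist_walk[OF assms(3,4)] by (auto simp: graph_ball_def)
  show "finite (\<Union>n\<in>{..r}. {y. (graph_adj E ^^ n) x0 y})"
    using finite_walk_ends[OF assms(1,2,4)] by blast
qed

lemma norm_sq_finite:
  assumes "finite B" "B \<subseteq> V" "\<And>x. x \<notin> B \<Longrightarrow> f x = 0"
  shows "norm_sq V f = (\<Sum>x\<in>B. (f x)\<^sup>2)"
proof -
  have "norm_sq V f = (\<Sum>\<^sub>\<infinity>x\<in>B. (f x)\<^sup>2)"
    unfolding norm_sq_def by (rule infsum_cong_neutral) (use assms in auto)
  then show ?thesis using assms(1) by simp
qed

lemma energy_finite:
  assumes "finite B" "B \<subseteq> V" "locally_finite_graph V E"
  shows "\<exists>P. finite P \<and> P \<subseteq> {(x, y). graph_adj E x y} \<and>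
    (\<forall>f. (\<forall>x. x \<notin> B \<longrightarrow> f x = 0) \<longrightarrow> energy E f = (\<Sum>(x, y)\<in>P. (f y - f x)\<^sup>2) / 2)"
proof -
  define P where "P = {(x, y). graph_adj E x y \<and> (x \<in> B \<or> y \<in> B)}"
  let ?Q = "Sigma B (\<lambda>x. {y. graph_adj E x y})"
  have "finite ?Q"
    using assms by (auto simp: locally_finite_graph_def)
  moreover have "P \<subseteq> ?Q \<union> prod.swap ` ?Q"
  proof
    fix p assume "p \<in> P"
    then obtain x y where p: "p = (x, y)" "graph_adj E x y" "x \<in> B \<or> y \<in> B"
      by (auto simp: P_def)
    then have "(x, y) \<in> ?Q \<or> (y, x) \<in> ?Q"
      using graph_adj_sym by fast
    then show "p \<in> ?Q \<union> prod.swap ` ?Q"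
      using p(1) by (metis UnI1 UnI2 image_eqI swap_simp)
  qed
  ultimately have fin: "finite P"
    by (meson finite_UnI finite_imageI finite_subset)
  have "energy E f = (\<Sum>(x, y)\<in>P. (f y - f x)\<^sup>2) / 2" if "\<forall>x. x \<notin> B \<longrightarrow> f x = 0" for f
  proof -
    have "energy E f = (\<Sum>\<^sub>\<infinity>(x, y)\<in>P. (f y - f x)\<^sup>2) / 2"
      unfolding energy_def
      by (intro arg_cong[where f = "\<lambda>z. z / 2"] infsum_cong_neutral) (use that in \<open>auto simp: P_def\<close>)
    then show ?thesis using fin by simp
  qed
  then show ?thesis using fin by (intro exI[of _ P]) (auto simp: P_def)
qed

lemma norm_sq_nonneg: "norm_sq V f \<ge> 0"
  unfolding norm_sq_def by (rule infsum_nonneg) simp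

lemma energy_nonneg: "energy E f \<ge> 0"
  unfolding energy_def by (intro divide_nonneg_pos infsum_nonneg) auto

lemma rayleigh_quotients_bdd_below: "bdd_below (rayleigh_quotients V E x0 r)"
  by (rule bdd_belowI[of _ 0])
    (auto simp: rayleigh_quotients_def norm_sq_nonneg energy_nonneg)

lemma graph_ball_nbr:
  assumes "x \<in> graph_ball V E x0 r" "x \<notin> graph_sphere V E x0 r" "graph_adj E x y"
  shows "y \<in> graph_ball V E x0 r"
  using assms by (auto simp: graph_sphere_def)

lemma dirichlet_functions_mono:
  assumes "r \<le> s"
  shows "dirichlet_functions V E x0 r \<subseteq> dirichlet_functions V E x0 s"
proof
  fix f assume f: "f \<in> dirichlet_functions V E x0 r"
  have sub: "graph_ball V E x0 r \<subseteq> graph_ball V E x0 s"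
    using assms by (auto simp: graph_ball_def)
  have "f x = 0" if "x \<in> graph_sphere V E x0 s" for x
  proof (rule ccontr)
    assume "f x \<noteq> 0"
    then have "x \<in> graph_ball V E x0 r" "x \<notin> graph_sphere V E x0 r"
      using f by (auto simp: dirichlet_functions_def)
    then show False
      using graph_ball_nbr sub that by (fastforce simp: graph_sphere_def)
  qed
  then show "f \<in> dirichlet_functions V E x0 s"
    using f sub by (auto simp: dirichlet_functions_def)
qed

lemma rayleigh_quotients_nonempty:
  assumes "simple_graph V E" "x0 \<in> V" "r \<ge> 1"
  shows "rayleigh_quotients V E x0 r \<noteq> {}"
proof -
  have "y \<in> graph_ball V E x0 r" if "graph_adj E x0 y" for y
  proof -
    have "(graph_adj E ^^ 1) x0 y" using that by (auto simp: relcompp_apply)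
    then have "graph_dist E x0 y \<le> 1"
      unfolding graph_dist_def by (rule Least_le)
    then show ?thesis
      using assms graph_adj_V[OF assms(1) that] by (auto simp: graph_ball_def)
  qed
  then have 1: "x0 \<notin> graph_sphere V E x0 r"
    by (auto simp: graph_sphere_def)
  have "(graph_adj E ^^ 0) x0 x0" by simp
  then have "graph_dist E x0 x0 \<le> 0"
    unfolding graph_dist_def by (rule Least_le)
  then have 2: "x0 \<in> graph_ball V E x0 r"
    using assms by (auto simp: graph_ball_def)
  have "(\<lambda>x. if x = x0 then 1 else 0) \<in> dirichlet_functions V E x0 r"
    using 1 2 by (auto simp: dirichlet_functions_def)
  moreover have "(\<lambda>x. if x = x0 then 1 else 0::real) \<noteq> (\<lambda>x. 0)"
    by (metis one_neq_zero)
  ultimately show ?thesis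
    unfolding rayleigh_quotients_def by blast
qed

theorem lambda0_ball_attained:
  assumes "simple_graph V E" "locally_finite_graph V E" "connected_graph V E" "x0 \<in> V" "r \<ge> 1"
  shows "lambda0_ball V E x0 r \<in> rayleigh_quotients V E x0 r \<and>
    (\<forall>q \<in> rayleigh_quotients V E x0 r. lambda0_ball V E x0 r \<le> q)"
proof -
  let ?B = "graph_ball V E x0 r" and ?C = "dirichlet_functions V E x0 r"
  have B: "finite ?B" "?B \<subseteq> V"
    using finite_graph_ball[OF assms(1-4)] by (auto simp: graph_ball_def)
  have C0: "f x = 0" if "f \<in> ?C" "x \<notin> ?B" for f x
    using that by (auto simp: dirichlet_functions_def)
  have N: "norm_sq V f = (\<Sum>x\<in>?B. (f x)\<^sup>2)" if "f \<in> ?C" for f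
    using norm_sq_finite[OF B] C0 that by blast
  obtain P where P: "energy E f = (\<Sum>(x, y)\<in>P. (f y - f x)\<^sup>2) / 2" if "f \<in> ?C" for f
    using energy_finite[OF B assms(2)] C0 by metis
  have scale: "(\<lambda>x. c * f x) \<in> ?C" if "f \<in> ?C" for f c
    using that by (auto simp: dirichlet_functions_def)
  define J where "J = (\<lambda>x. if x \<in> ?B - graph_sphere V E x0 r then {-1..1::real} else {0})"
  define K where "K = PiE UNIV J \<inter> {f. (\<Sum>x\<in>?B. (f x)\<^sup>2) = 1}"
  have KC: "K = {f \<in> ?C. norm_sq V f = 1}"
  proof (intro equalityI subsetI)
    fix f assume f: "f \<in> K"
    then have "f x \<in> J x" for x by (auto simp: K_def)
    then have "f \<in> ?C"
      unfolding dirichlet_functions_def J_def graph_sphere_def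
      by (auto split: if_splits) (metis (no_types, lifting) singletonD)+
    then show "f \<in> {f \<in> ?C. norm_sq V f = 1}"
      using f N by (auto simp: K_def)
  next
    fix f assume f: "f \<in> {f \<in> ?C. norm_sq V f = 1}"
    then have s: "(\<Sum>x\<in>?B. (f x)\<^sup>2) = 1" using N by auto
    have "f x \<in> J x" for x
    proof (cases "x \<in> ?B - graph_sphere V E x0 r")
      case True
      then have "(f x)\<^sup>2 \<le> (\<Sum>x\<in>?B. (f x)\<^sup>2)"
        using B by (intro member_le_sum) auto
      then have "\<bar>f x\<bar> \<le> 1" using s by (simp add: abs_square_le_1)
      then show ?thesis using True by (auto simp: J_def)
    next
      case False
      then show ?thesis using f by (auto simp: J_def dirichlet_functions_def)
    qed
    then show "f \<in> K" using s by (auto simp: K_def)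
  qed
  have "compactin euclidean (PiE UNIV J)"
    unfolding euclidean_product_topology[symmetric] compactin_PiE
    by (auto simp: J_def)
  moreover have "closed {f :: 'a \<Rightarrow> real. (\<Sum>x\<in>?B. (f x)\<^sup>2) = 1}"
    by (intro closed_Collect_eq continuous_intros continuous_on_product_coordinates)
  ultimately have "compact K"
    unfolding K_def by (simp add: compact_Int_closed)
  have norm_pos: "norm_sq V f > 0" if f: "f \<in> ?C" "f \<noteq> (\<lambda>x. 0)" for f
  proof -
    obtain x where "f x \<noteq> 0" using f(2) by blast
    then have "x \<in> ?B" using C0 f(1) by blast
    then show ?thesis
      unfolding N[OF f(1)] using \<open>f x \<noteq> 0\<close> B by (intro sum_pos2[of _ x]) auto
  qed
  have normalize: "\<exists>g\<in>K. energy E g = energy E f / norm_sq V f"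
    if "f \<in> ?C" "f \<noteq> (\<lambda>x. 0)" for f
  proof -
    define c where "c = 1 / sqrt (norm_sq V f)"
    have c2: "c\<^sup>2 = 1 / norm_sq V f"
      using norm_pos[OF that] by (simp add: c_def power_divide)
    have g: "(\<lambda>x. c * f x) \<in> ?C" using scale that(1) .
    have "norm_sq V (\<lambda>x. c * f x) = c\<^sup>2 * norm_sq V f"
      using N[OF g] N[OF that(1)] by (simp add: power_mult_distrib sum_distrib_left)
    moreover have "energy E (\<lambda>x. c * f x) = c\<^sup>2 * energy E f"
      unfolding P[OF g] P[OF that(1)]
      by (simp add: power_mult_distrib sum_distrib_left case_prod_unfold flip: right_diff_distrib)
    ultimately show ?thesis
      using g c2 norm_pos[OF that] unfolding KC
      by (intro bexI[of _ "\<lambda>x. c * f x"]) auto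
  qed
  have "K \<noteq> {}"
    using rayleigh_quotients_nonempty[OF assms(1,4,5)] normalize
    unfolding rayleigh_quotients_def by blast
  have "continuous_on K (\<lambda>f. (\<Sum>(x, y)\<in>P. (f y - f x)\<^sup>2) / 2)"
    unfolding case_prod_unfold
    by (intro continuous_intros continuous_on_subset[OF continuous_on_product_coordinates]) auto
  then have "continuous_on K (energy E)"
    by (rule continuous_on_eq) (use P KC in auto)
  then obtain g where g: "g \<in> K" "\<forall>f\<in>K. energy E g \<le> energy E f"
    using continuous_attains_inf[OF \<open>compact K\<close> \<open>K \<noteq> {}\<close>] by blast
  have g0: "g \<noteq> (\<lambda>x. 0)"
  proof
    assume "g = (\<lambda>x. 0)"
    then show False using g(1) by (simp add: K_def)
  qed
  have mem: "energy E g \<in> rayleigh_quotients V E x0 r"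
    unfolding rayleigh_quotients_def using g(1) g0 KC by force
  have le: "energy E g \<le> q" if q: "q \<in> rayleigh_quotients V E x0 r" for q
  proof -
    obtain f where f: "f \<in> ?C" "f \<noteq> (\<lambda>x. 0)" "q = energy E f / norm_sq V f"
      using q by (auto simp: rayleigh_quotients_def)
    then show ?thesis using normalize[OF f(1,2)] g(2) by auto
  qed
  have "lambda0_ball V E x0 r = energy E g"
    unfolding lambda0_ball_def by (rule cInf_eq_minimum[OF mem le])
  then show ?thesis using mem le by simp
qed

theorem lambda0_limit:
  assumes "simple_graph V E" "x0 \<in> V"
  shows "(\<lambda>r. lambda0_ball V E x0 r) \<longlonglongrightarrow> lambda0 V E x0"
proof -
  have "decseq (\<lambda>r. lambda0_ball V E x0 (Suc r))"
  proof (rule antimonoI)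
    fix r s :: nat assume "r \<le> s"
    then have "rayleigh_quotients V E x0 (Suc r) \<subseteq> rayleigh_quotients V E x0 (Suc s)"
      using dirichlet_functions_mono[of "Suc r" "Suc s" V E x0]
      unfolding rayleigh_quotients_def by blast
    then show "lambda0_ball V E x0 (Suc s) \<le> lambda0_ball V E x0 (Suc r)"
      unfolding lambda0_ball_def
      using rayleigh_quotients_nonempty[OF assms] rayleigh_quotients_bdd_below
      by (intro cInf_superset_mono) auto
  qed
  moreover have "0 \<le> lambda0_ball V E x0 (Suc r)" for r
    unfolding lambda0_ball_def
    using rayleigh_quotients_nonempty[OF assms, of "Suc r"]
    by (intro cInf_greatest) (auto simp: rayleigh_quotients_def norm_sq_nonneg energy_nonneg)
  ultimately obtain L where "(\<lambda>r. lambda0_ball V E x0 (Suc r)) \<longlonglongrightarrow> L"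
    using decseq_convergent by blast
  then have "convergent (\<lambda>r. lambda0_ball V E x0 r)"
    by (auto simp: convergent_def filterlim_sequentially_Suc)
  then show ?thesis
    unfolding lambda0_def by (simp add: convergent_LIMSEQ_iff)
qed

end

theory Submission
  imports Defs
begin

text \<open>If \<open>v\<close> is positive and \<open>\<lambda>\<close>-harmonic, summing the Picone inequality
  \<open>(f y - f x)\<^sup>2 \<ge> (f x)\<^sup>2 (1 - v y / v x) + (f y)\<^sup>2 (1 - v x / v y)\<close> over the edges shows that
  every Rayleigh quotient is at least \<open>\<lambda>\<close>, so \<open>\<lambda> \<le> \<lambda>\<^sub>0\<close>.

  Conversely let \<open>\<lambda> \<le> \<lambda>\<^sub>0\<close> and \<open>0 < \<epsilon> \<le> 1\<close>. On a finite set \<open>U\<close> the equation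
  \<open>\<Delta>w = (\<lambda> - \<epsilon>) w\<close> with value \<open>1\<close> outside \<open>U\<close> is solved by monotone iteration from \<open>0\<close>;
  the gap \<open>\<epsilon>\<close> below the spectrum bounds the iterates in \<open>\<ell>\<^sup>2(U)\<close>. Normalized at \<open>x0\<close>, these
  positive solutions satisfy Harnack bounds along walks from \<open>x0\<close>, and Tychonoff's theorem
  yields a nonnegative \<open>\<lambda>\<close>-harmonic limit as \<open>U\<close> exhausts \<open>V\<close> and \<open>\<epsilon> \<rightarrow> 0\<close>. It does not
  vanish at \<open>x0\<close>, hence nowhere.\<close>

section \<open>Sums over edges and Green's formula\<close>

lemma locally_finite_nbrs:
  assumes "simple_graph V E" "locally_finite_graph V E"
  shows "finite {y. graph_adj E x y}"
proof (cases "x \<in> V")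
  case True
  then show ?thesis using assms(2) by (simp add: locally_finite_graph_def)
next
  case False
  then have "{y. graph_adj E x y} = {}" using graph_adj_V[OF assms(1)] by blast
  then show ?thesis by simp
qed

lemma not_graph_adj_self: "simple_graph V E \<Longrightarrow> \<not> graph_adj E x x"
  by (auto simp: simple_graph_def graph_adj_def)

lemma laplacian_eq_degree:
  "laplacian E f x = real (card {y. graph_adj E x y}) * f x - (\<Sum>y | graph_adj E x y. f y)"
  by (simp add: laplacian_def sum_subtractf)

text \<open>Each edge appears in both orientations, matching the factor 1/2 in
  \<open>energy\<close>. For a function supported in \<open>U\<close> all nonzero terms of the
  energy lie here.\<close>

definition edges_at :: "'a set set \<Rightarrow> 'a set \<Rightarrow> ('a \<times> 'a) set" where
  "edges_at E U = {(x, y). graph_adj E x y \<and> (x \<in> U \<or> y \<in> U)}"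

lemma edges_at_eq:
  "edges_at E U = Sigma U (\<lambda>x. {y. graph_adj E x y}) \<union> prod.swap ` Sigma U (\<lambda>x. {y. graph_adj E x y})"
  using graph_adj_sym[of E] by (auto simp: edges_at_def image_iff)

lemma finite_edges_at:
  assumes "simple_graph V E" "locally_finite_graph V E" "finite U"
  shows "finite (edges_at E U)"
  using assms(3) locally_finite_nbrs[OF assms(1,2)] unfolding edges_at_eq by blast

lemma energy_eq_sum_edges_at:
  assumes "simple_graph V E" "locally_finite_graph V E" "finite U"
    and "\<And>x. x \<notin> U \<Longrightarrow> f x = 0"
  shows "energy E f = (\<Sum>(x, y)\<in>edges_at E U. (f y - f x)\<^sup>2) / 2"
proof -
  have supp: "x \<in> U" if "f x \<noteq> 0" for x
    using assms(4) that by blast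
  have "energy E f = (\<Sum>\<^sub>\<infinity>(x, y)\<in>edges_at E U. (f y - f x)\<^sup>2) / 2"
    unfolding energy_def
    by (intro arg_cong[where f = "\<lambda>z. z / 2"] infsum_cong_neutral)
      (auto simp: edges_at_def, metis supp)
  then show ?thesis using finite_edges_at[OF assms(1-3)] by simp
qed

text \<open>Reversing pairs maps \<open>edges_at E U\<close> onto itself, so both summands
  contribute equally; the pairs starting outside \<open>U\<close> then drop out.\<close>

lemma sum_edges_at_symmetrized:
  fixes g :: "'a \<Rightarrow> 'a \<Rightarrow> real"
  assumes "simple_graph V E" "locally_finite_graph V E" "finite U"
    and "\<And>x y. x \<notin> U \<Longrightarrow> g x y = 0"
  shows "(\<Sum>(x, y)\<in>edges_at E U. g x y + g y x) = 2 * (\<Sum>x\<in>U. \<Sum>y | graph_adj E x y. g x y)"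
proof -
  have supp: "x \<in> U" if "g x y \<noteq> 0" for x y
    using assms(4) that by blast
  let ?P = "edges_at E U" and ?Q = "Sigma U (\<lambda>x. {y. graph_adj E x y})"
  have swap: "prod.swap ` ?P = ?P" by (simp add: edges_at_eq image_Un image_image Un_commute)
  have "(\<Sum>(x, y)\<in>?P. g y x) = (\<Sum>(x, y)\<in>prod.swap ` ?P. g y x)" by (simp only: swap)
  also have "\<dots> = (\<Sum>(x, y)\<in>?P. g x y)"
    by (subst sum.reindex) (auto simp: case_prod_unfold)
  finally have "(\<Sum>(x, y)\<in>?P. g x y + g y x) = 2 * (\<Sum>(x, y)\<in>?P. g x y)"
    by (simp add: case_prod_unfold sum.distrib)
  also have "(\<Sum>(x, y)\<in>?P. g x y) = (\<Sum>(x, y)\<in>?Q. g x y)"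
    by (rule sum.mono_neutral_right[OF finite_edges_at[OF assms(1-3)]])
      (auto simp: edges_at_def dest: supp)
  also have "\<dots> = (\<Sum>x\<in>U. \<Sum>y | graph_adj E x y. g x y)"
    using assms(3) locally_finite_nbrs[OF assms(1,2)] by (subst sum.Sigma) auto
  finally show ?thesis .
qed

text \<open>The squared difference is the symmetrization of \<open>f x * (f x - f y)\<close>, which
  vanishes for \<open>x\<close> outside \<open>U\<close>.\<close>

lemma green_formula:
  assumes "simple_graph V E" "locally_finite_graph V E" "finite U"
    and "\<And>x. x \<notin> U \<Longrightarrow> f x = 0"
  shows "energy E f = (\<Sum>x\<in>U. f x * laplacian E f x)"
proof -
  have "(f y - f x)\<^sup>2 = f x * (f x - f y) + f y * (f y - f x)" for x y
    by (simp add: power2_eq_square algebra_simps)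
  then have "energy E f = (\<Sum>(x, y)\<in>edges_at E U. f x * (f x - f y) + f y * (f y - f x)) / 2"
    by (simp add: energy_eq_sum_edges_at[OF assms])
  also have "\<dots> = (\<Sum>x\<in>U. \<Sum>y | graph_adj E x y. f x * (f x - f y))"
    using sum_edges_at_symmetrized[OF assms(1-3), of "\<lambda>x y. f x * (f x - f y)"] assms(4) by simp
  finally show ?thesis by (simp add: laplacian_def sum_distrib_left)
qed

section \<open>Positive harmonic functions bound the spectrum from below\<close>

lemma picone_inequality:
  fixes a b p q :: real
  assumes "p > 0" "q > 0"
  shows "a\<^sup>2 * (1 - q / p) + b\<^sup>2 * (1 - p / q) \<le> (b - a)\<^sup>2"
proof -
  have "(b - a)\<^sup>2 - (a\<^sup>2 * (1 - q / p) + b\<^sup>2 * (1 - p / q)) = (a * q - b * p)\<^sup>2 / (p * q)"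
    using assms by (simp add: field_simps power2_eq_square)
  moreover have "\<dots> \<ge> 0" using assms by simp
  ultimately show ?thesis by linarith
qed

text \<open>Summed over the neighbours of a fixed \<open>x\<close>, the Picone terms based at
  \<open>x\<close> give \<open>(f x)^2 * laplacian E v x / v x\<close>, which harmonicity turns into
  \<open>c * (f x)^2\<close>.\<close>

lemma energy_ge_of_positive_harmonic:
  assumes "simple_graph V E" "locally_finite_graph V E" "finite U" "U \<subseteq> V"
    and "\<And>x. x \<notin> U \<Longrightarrow> f x = 0"
    and "harmonic_fn V E c v" "\<And>x. x \<in> V \<Longrightarrow> v x > 0"
  shows "c * norm_sq V f \<le> energy E f"
proof -
  have "(\<Sum>y | graph_adj E x y. (f x)\<^sup>2 * (1 - v y / v x)) = c * (f x)\<^sup>2" if "x \<in> U" for x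
  proof -
    have x: "x \<in> V" "v x > 0" using that assms(4,7) by auto
    have "(\<Sum>y | graph_adj E x y. (f x)\<^sup>2 * (1 - v y / v x))
        = (\<Sum>y | graph_adj E x y. (f x)\<^sup>2 / v x * (v x - v y))"
      using x by (intro sum.cong) (simp_all add: field_simps)
    also have "\<dots> = (f x)\<^sup>2 / v x * laplacian E v x"
      by (simp add: laplacian_def sum_distrib_left)
    finally show ?thesis using x assms(6) by (simp add: harmonic_fn_def)
  qed
  then have "c * norm_sq V f = (\<Sum>x\<in>U. \<Sum>y | graph_adj E x y. (f x)\<^sup>2 * (1 - v y / v x))"
    using norm_sq_finite[OF assms(3,4), of f] assms(5) by (simp add: sum_distrib_left)
  also have "\<dots> = (\<Sum>(x, y)\<in>edges_at E U. (f x)\<^sup>2 * (1 - v y / v x) + (f y)\<^sup>2 * (1 - v x / v y)) / 2"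
    using sum_edges_at_symmetrized[OF assms(1-3), of "\<lambda>x y. (f x)\<^sup>2 * (1 - v y / v x)"] assms(5)
    by simp
  also have "\<dots> \<le> (\<Sum>(x, y)\<in>edges_at E U. (f y - f x)\<^sup>2) / 2"
  proof (intro divide_right_mono sum_mono)
    fix p assume "p \<in> edges_at E U"
    then obtain x y where p: "p = (x, y)" and xy: "graph_adj E x y" by (auto simp: edges_at_def)
    have "v x > 0" "v y > 0" using assms(7) graph_adj_V[OF assms(1) xy] by auto
    then show "(case p of (x, y) \<Rightarrow> (f x)\<^sup>2 * (1 - v y / v x) + (f y)\<^sup>2 * (1 - v x / v y))
        \<le> (case p of (x, y) \<Rightarrow> (f y - f x)\<^sup>2)"
      using p picone_inequality by simp
  qed simp
  finally show ?thesis using energy_eq_sum_edges_at[OF assms(1-3), of f] assms(5) by simp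
qed

lemma norm_sq_pos:
  assumes "finite U" "U \<subseteq> V" "\<And>x. x \<notin> U \<Longrightarrow> f x = 0" "f \<noteq> (\<lambda>x. 0)"
  shows "norm_sq V f > 0"
proof -
  obtain x where x: "f x \<noteq> 0" using assms(4) by blast
  then have "x \<in> U" using assms(3) by blast
  then have "(\<Sum>x\<in>U. (f x)\<^sup>2) > 0" using x assms(1) by (intro sum_pos2[of _ x]) auto
  then show ?thesis using norm_sq_finite[of U V f] assms(1-3) by simp
qed

lemma le_lambda0_of_positive_harmonic:
  assumes "simple_graph V E" "locally_finite_graph V E" "connected_graph V E" "x0 \<in> V"
    and "harmonic_fn V E c v" "\<And>x. x \<in> V \<Longrightarrow> v x > 0"
  shows "c \<le> lambda0 V E x0"
proof (rule LIMSEQ_le_const[OF lambda0_limit[OF assms(1,4)]], intro exI allI impI)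
  fix r :: nat assume "1 \<le> r"
  \<comment> \<open>The infimum is attained, so it suffices to test one minimizer. Radius 0, where
    there may be no admissible function, is skipped.\<close>
  then have "lambda0_ball V E x0 r \<in> rayleigh_quotients V E x0 r"
    using lambda0_ball_attained[OF assms(1-4)] by blast
  then obtain f where f: "f \<in> dirichlet_functions V E x0 r" "f \<noteq> (\<lambda>x. 0)"
    "lambda0_ball V E x0 r = energy E f / norm_sq V f"
    by (auto simp: rayleigh_quotients_def)
  have B: "finite (graph_ball V E x0 r)" "graph_ball V E x0 r \<subseteq> V"
    using finite_graph_ball[OF assms(1-4)] by (auto simp: graph_ball_def)
  have f0: "\<And>x. x \<notin> graph_ball V E x0 r \<Longrightarrow> f x = 0"
    using f(1) by (auto simp: dirichlet_functions_def)
  have "c * norm_sq V f \<le> energy E f"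
    by (rule energy_ge_of_positive_harmonic[OF assms(1,2) B f0 assms(5,6)])
  moreover have "norm_sq V f > 0" by (rule norm_sq_pos[OF B f0 f(2)])
  ultimately show "c \<le> lambda0_ball V E x0 r"
    by (simp add: f(3) pos_le_divide_eq)
qed

section \<open>The spectral bound for all finitely supported functions\<close>

lemma lambda0_le_lambda0_ball:
  assumes "simple_graph V E" "x0 \<in> V" "r \<ge> 1"
  shows "lambda0 V E x0 \<le> lambda0_ball V E x0 r"
proof (rule LIMSEQ_le_const2[OF lambda0_limit[OF assms(1,2)]], intro exI allI impI)
  fix s assume "r \<le> s"
  then have "rayleigh_quotients V E x0 r \<subseteq> rayleigh_quotients V E x0 s"
    using dirichlet_functions_mono[of r s V E x0] unfolding rayleigh_quotients_def by blast
  then show "lambda0_ball V E x0 s \<le> lambda0_ball V E x0 r"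
    unfolding lambda0_ball_def
    by (intro cInf_superset_mono rayleigh_quotients_nonempty[OF assms] rayleigh_quotients_bdd_below)
qed

text \<open>Any finite \<open>U\<close> lies in the interior of a large ball, so \<open>f\<close> is
  a Dirichlet function there. The product form also covers \<open>f = 0\<close>.\<close>

lemma lambda0_le_energy:
  assumes "simple_graph V E" "connected_graph V E" "x0 \<in> V"
    and "finite U" "U \<subseteq> V" "\<And>x. x \<notin> U \<Longrightarrow> f x = 0"
  shows "lambda0 V E x0 * norm_sq V f \<le> energy E f"
proof (cases "f = (\<lambda>x. 0)")
  case True
  then show ?thesis using energy_nonneg[of E f] by (simp add: norm_sq_def)
next
  case False
  obtain m where m: "\<And>x. x \<in> U \<Longrightarrow> graph_dist E x0 x \<le> m"
    using finite_nat_set_iff_bounded_le[of "graph_dist E x0 ` U"] assms(4) by auto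
  \<comment> \<open>Neighbours of \<open>U\<close> have distance at most \<open>m + 1\<close>;
    radius \<open>Suc m\<close> thus keeps \<open>U\<close> off the sphere, where \<open>f\<close>
    would have to vanish.\<close>
  have U: "x \<in> graph_ball V E x0 (Suc m) - graph_sphere V E x0 (Suc m)" if "x \<in> U" for x
  proof -
    have "y \<in> graph_ball V E x0 (Suc m)" if y: "graph_adj E x y" for y
    proof -
      have "(graph_adj E ^^ Suc (graph_dist E x0 x)) x0 y"
        using graph_dist_walk[OF assms(2,3)] \<open>x \<in> U\<close> assms(5) y by auto
      then have "graph_dist E x0 y \<le> Suc (graph_dist E x0 x)"
        unfolding graph_dist_def[of E x0 y] by (rule Least_le)
      then show ?thesis
        using m[OF \<open>x \<in> U\<close>] graph_adj_V[OF assms(1) y] by (auto simp: graph_ball_def)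
    qed
    then show ?thesis
      using m[OF that] that assms(5) by (auto simp: graph_ball_def[of V E x0] graph_sphere_def)
  qed
  have "f \<in> dirichlet_functions V E x0 (Suc m)"
    unfolding dirichlet_functions_def using U assms(6) by blast
  then have "energy E f / norm_sq V f \<in> rayleigh_quotients V E x0 (Suc m)"
    using False by (auto simp: rayleigh_quotients_def)
  then have "lambda0_ball V E x0 (Suc m) \<le> energy E f / norm_sq V f"
    unfolding lambda0_ball_def by (rule cInf_lower[OF _ rayleigh_quotients_bdd_below])
  then have "lambda0 V E x0 \<le> energy E f / norm_sq V f"
    using lambda0_le_lambda0_ball[OF assms(1,3), of "Suc m"] by simp
  then show ?thesis
    using norm_sq_pos[OF assms(4-6) False] by (simp add: field_simps)
qed

section \<open>Positive solutions on finite sets\<close>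

text \<open>Strong minimum principle: at a zero the Laplacian is minus a sum of nonnegative
  neighbour values, so zeros spread to all neighbours. Asking for the equation only at zeros lets
  this apply both to solutions on \<open>U\<close> with value 1 outside and to the final
  limit.\<close>

lemma positive_if_nonneg_harmonic:
  assumes "simple_graph V E" "locally_finite_graph V E" "connected_graph V E"
    and nonneg: "\<And>x. x \<in> V \<Longrightarrow> w x \<ge> 0"
    and harm: "\<And>x. x \<in> V \<Longrightarrow> w x = 0 \<Longrightarrow> laplacian E w x = 0"
    and "a \<in> V" "w a > 0" "b \<in> V"
  shows "w b > 0"
proof -
  have "(graph_adj E)\<^sup>*\<^sup>* a b" using assms(3,6,8) by (auto simp: connected_graph_def)
  then show ?thesis
  proof induction
    case base
    then show ?case by fact
  next
    case (step y z)
    have yz: "y \<in> V" "z \<in> V" using graph_adj_V[OF assms(1) step(2)] by auto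
    show ?case
    proof (rule ccontr)
      assume "\<not> w z > 0"
      then have z: "w z = 0" using nonneg yz by force
      have "w y \<le> (\<Sum>u | graph_adj E z u. w u)"
        using graph_adj_sym[OF step(2)] nonneg graph_adj_V[OF assms(1)]
          locally_finite_nbrs[OF assms(1,2)]
        by (intro member_le_sum) auto
      then show False
        using harm[OF yz(2) z] z step(3) by (simp add: laplacian_eq_degree)
    qed
  qed
qed

lemma dirichlet_solution:
  assumes "simple_graph V E" "locally_finite_graph V E" "finite U" "U \<subseteq> V" "\<epsilon> > 0"
    and gap: "\<And>f. (\<And>x. x \<notin> U \<Longrightarrow> f x = 0) \<Longrightarrow> (c + \<epsilon>) * norm_sq V f \<le> energy E f"
  shows "\<exists>w. (\<forall>x. w x \<ge> 0) \<and> (\<forall>x. x \<notin> U \<longrightarrow> w x = 1) \<and> (\<forall>x\<in>U. laplacian E w x = c * w x)"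
proof -
  define d where "d x = real (card {y. graph_adj E x y})" for x
  \<comment> \<open>The indicator of \<open>x\<close> has Rayleigh quotient \<open>d x\<close>, so
    \<open>gap\<close> gives \<open>d x \<ge> c + \<epsilon>\<close>. This makes the operator
    \<open>T\<close> below monotone.\<close>
  have dc: "d x - c > 0" if "x \<in> U" for x
  proof -
    let ?f = "\<lambda>y. if y = x then 1 else 0 :: real"
    have f0: "?f y = 0" if "y \<notin> {x}" for y using that by simp
    have "(\<Sum>y | graph_adj E x y. ?f y) = 0"
      using not_graph_adj_self[OF assms(1)] by (intro sum.neutral) auto
    then have "energy E ?f = d x"
      using green_formula[OF assms(1,2) _ f0, of "{x}"] by (simp add: laplacian_eq_degree d_def)
    moreover have "norm_sq V ?f = 1"
      using norm_sq_finite[of "{x}" V ?f] that assms(4) by auto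
    ultimately show ?thesis using gap[of ?f] that assms(5) by force
  qed
  \<comment> \<open>The equation at \<open>x\<close> is solved for the value at \<open>x\<close>;
    fixed points of \<open>T\<close> are exactly the solutions with boundary value 1.\<close>
  define T where "T v x = (if x \<in> U then (\<Sum>y | graph_adj E x y. v y) / (d x - c) else 1)"
    for v :: "'a \<Rightarrow> real" and x
  define v where "v k = (T ^^ k) (\<lambda>x. if x \<in> U then 0 else 1)" for k
  have vSuc: "v (Suc k) = T (v k)" for k by (simp add: v_def)
  have vout: "v k x = 1" if "x \<notin> U" for k x
    using that by (cases k) (auto simp: v_def T_def)
  have T_mono: "T f x \<le> T g x" if "\<And>x. f x \<le> g x" for f g x
    using that dc[of x] by (auto simp: T_def intro!: divide_right_mono sum_mono)
  have v_nonneg: "v k x \<ge> 0" for k x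
  proof (induction k arbitrary: x)
    case (Suc k)
    then show ?case
      using dc[of x] by (auto simp: vSuc T_def intro!: divide_nonneg_pos sum_nonneg)
  qed (auto simp: v_def)
  have v_le: "v k x \<le> v (Suc k) x" for k x
  proof (induction k arbitrary: x)
    case 0
    then show ?case using v_nonneg[of "Suc 0" x] vout[of x "Suc 0"] by (auto simp: v_def)
  next
    case (Suc k)
    then show ?case unfolding vSuc[of k] vSuc[of "Suc k"] by (rule T_mono)
  qed
  \<comment> \<open>Solves \<open>\<epsilon> * S \<le> (\<epsilon> / 2) * S + D / (2 *
    \<epsilon>)\<close> for \<open>S\<close>, with \<open>S\<close> and \<open>D\<close> the sums of
    squares over \<open>U\<close> of the iterate and of \<open>d\<close>.\<close>
  define M where "M = (\<Sum>x\<in>U. (d x)\<^sup>2) / \<epsilon>\<^sup>2"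
  have bound: "v k x \<le> 1 + M" for k x
  proof (cases "x \<in> U")
    case False
    then show ?thesis by (simp add: vout M_def sum_nonneg)
  next
    case True
    \<comment> \<open>Cutting off the boundary values makes \<open>gap\<close> applicable. Since the
      iterates increase, \<open>z\<close> is a subsolution up to an error \<open>d x\<close>, at
      most 1 for each neighbour.\<close>
    define z where "z x = (if x \<in> U then v k x else 0)" for x
    have z0: "\<And>x. x \<notin> U \<Longrightarrow> z x = 0" by (simp add: z_def)
    have zU: "z x * laplacian E z x \<le> c * (z x)\<^sup>2 + z x * d x" if x: "x \<in> U" for x
    proof -
      have "(d x - c) * z x \<le> (d x - c) * v (Suc k) x"
        using v_le dc[OF x] x by (simp add: z_def mult_left_mono)
      also have "\<dots> = (\<Sum>y | graph_adj E x y. v k y)"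
        using dc[OF x] x by (simp add: vSuc T_def)
      also have "\<dots> \<le> (\<Sum>y | graph_adj E x y. z y + 1)"
        by (intro sum_mono) (simp add: z_def vout)
      also have "\<dots> = (\<Sum>y | graph_adj E x y. z y) + d x"
        by (simp add: sum.distrib d_def)
      finally have "laplacian E z x \<le> c * z x + d x"
        by (simp add: laplacian_eq_degree flip: d_def) (simp add: algebra_simps)
      then have "z x * laplacian E z x \<le> z x * (c * z x + d x)"
        using v_nonneg by (intro mult_left_mono) (simp_all add: z_def)
      then show ?thesis by (simp add: algebra_simps power2_eq_square)
    qed
    have N: "norm_sq V z = (\<Sum>x\<in>U. (z x)\<^sup>2)" by (rule norm_sq_finite[OF assms(3,4) z0])
    have "(c + \<epsilon>) * norm_sq V z \<le> (\<Sum>x\<in>U. c * (z x)\<^sup>2 + z x * d x)"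
      using gap[OF z0] green_formula[OF assms(1-3) z0] sum_mono[OF zU] by force
    then have "\<epsilon> * (\<Sum>x\<in>U. (z x)\<^sup>2) \<le> (\<Sum>x\<in>U. z x * d x)"
      by (simp add: N sum.distrib algebra_simps flip: sum_distrib_left)
    also have "\<dots> \<le> (\<Sum>x\<in>U. (\<epsilon> / 2) * (z x)\<^sup>2 + (d x)\<^sup>2 / (2 * \<epsilon>))"
    proof (rule sum_mono)
      fix x
      have "0 \<le> (\<epsilon> * z x - d x)\<^sup>2 / (2 * \<epsilon>)" using assms(5) by simp
      also have "\<dots> = (\<epsilon> / 2) * (z x)\<^sup>2 + (d x)\<^sup>2 / (2 * \<epsilon>) - z x * d x"
        using assms(5) by (simp add: field_simps power2_eq_square)
      finally show "z x * d x \<le> (\<epsilon> / 2) * (z x)\<^sup>2 + (d x)\<^sup>2 / (2 * \<epsilon>)" by simp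
    qed
    also have "\<dots> = (\<epsilon> / 2) * (\<Sum>x\<in>U. (z x)\<^sup>2) + (\<Sum>x\<in>U. (d x)\<^sup>2) / (2 * \<epsilon>)"
      by (simp only: sum.distrib sum_distrib_left sum_divide_distrib)
    finally have "(\<Sum>x\<in>U. (z x)\<^sup>2) \<le> M"
      using assms(5) by (simp add: M_def field_simps power2_eq_square)
    moreover have "(z x)\<^sup>2 \<le> (\<Sum>x\<in>U. (z x)\<^sup>2)"
      using True assms(3) by (intro member_le_sum) auto
    moreover have "z x \<le> 1 + (z x)\<^sup>2"
      using zero_le_power2[of "z x - 1 / 2"] by (simp add: power2_eq_square algebra_simps)
    ultimately show ?thesis using True by (simp add: z_def)
  qed
  define w where "w x = lim (\<lambda>k. v k x)" for x
  have lim: "(\<lambda>k. v k x) \<longlonglongrightarrow> w x" for x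
  proof -
    have "incseq (\<lambda>k. v k x)" using v_le by (rule incseq_SucI)
    then have "\<exists>L. (\<lambda>k. v k x) \<longlonglongrightarrow> L"
      by (rule incseq_convergent[of _ "1 + M"]) (use bound in blast)+
    then show ?thesis unfolding w_def by (auto simp: limI)
  qed
  have "laplacian E w x = c * w x" if x: "x \<in> U" for x
  proof -
    have "(\<lambda>k. (\<Sum>y | graph_adj E x y. v k y) / (d x - c))
        \<longlonglongrightarrow> (\<Sum>y | graph_adj E x y. w y) / (d x - c)"
      using dc[OF x] by (intro tendsto_intros lim) auto
    moreover have "(\<lambda>k. (\<Sum>y | graph_adj E x y. v k y) / (d x - c)) \<longlonglongrightarrow> w x"
      using LIMSEQ_Suc[OF lim[of x]] x by (simp add: vSuc T_def)
    ultimately have "w x = (\<Sum>y | graph_adj E x y. w y) / (d x - c)"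
      by (rule LIMSEQ_unique[rotated])
    then have "w x * (d x - c) = (\<Sum>y | graph_adj E x y. w y)"
      using dc[OF x] by (metis less_irrefl nonzero_eq_divide_eq)
    then show ?thesis by (simp add: laplacian_eq_degree algebra_simps flip: d_def)
  qed
  moreover have "w x \<ge> 0" for x
    using lim by (rule LIMSEQ_le_const) (use v_nonneg in auto)
  moreover have "w x = 1" if "x \<notin> U" for x
    using lim[of x] vout[OF that] by (simp add: LIMSEQ_const_iff)
  ultimately show ?thesis by blast
qed

lemma positive_solution_on_finite:
  assumes "simple_graph V E" "infinite V" "locally_finite_graph V E" "connected_graph V E"
    and "x0 \<in> V" "finite U" "U \<subseteq> V" "c < lambda0 V E x0"
  shows "\<exists>w. (\<forall>x\<in>V. w x > 0) \<and> w x0 = 1 \<and> (\<forall>x\<in>U. laplacian E w x = c * w x)"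
proof -
  have "(c + (lambda0 V E x0 - c)) * norm_sq V f \<le> energy E f" if "\<And>x. x \<notin> U \<Longrightarrow> f x = 0" for f
    using lambda0_le_energy[OF assms(1,4-7) that] by simp
  then have "\<exists>w. (\<forall>x. w x \<ge> 0) \<and> (\<forall>x. x \<notin> U \<longrightarrow> w x = 1) \<and> (\<forall>x\<in>U. laplacian E w x = c * w x)"
    using assms(8) by (intro dirichlet_solution[OF assms(1,3,6,7), of "lambda0 V E x0 - c"]) auto
  then obtain w where w: "\<And>x. w x \<ge> 0" "\<And>x. x \<notin> U \<Longrightarrow> w x = 1"
    "\<And>x. x \<in> U \<Longrightarrow> laplacian E w x = c * w x"
    by blast
  \<comment> \<open>An infinite \<open>V\<close> has a vertex outside \<open>U\<close>; the boundary
    value 1 there is the seed from which positivity spreads.\<close>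
  obtain a where a: "a \<in> V" "a \<notin> U"
    using assms(2,6) by (meson finite_subset subsetI)
  have harm: "laplacian E w x = 0" if "w x = 0" for x
    using w(2)[of x] w(3)[of x] that by (cases "x \<in> U") auto
  have pos: "w b > 0" if "b \<in> V" for b
    by (rule positive_if_nonneg_harmonic[OF assms(1,3,4) w(1) _ a(1) _ that])
      (use w(2)[OF a(2)] harm in simp_all)
  have "laplacian E (\<lambda>x. w x / w x0) x = laplacian E w x / w x0" for x
    by (simp add: laplacian_def sum_divide_distrib diff_divide_distrib)
  then show ?thesis
    using pos pos[OF assms(5)] w(3)
    by (intro exI[of _ "\<lambda>x. w x / w x0"] conjI ballI) simp_all
qed

section \<open>Harnack bounds and the compactness argument\<close>

text \<open>The equation at a vertex bounds each neighbour's value by a multiple of its own value;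
  iterating along a walk multiplies the constants. \<open>P\<close> and \<open>C\<close> depend on
  neither \<open>w\<close> nor \<open>a\<close>, so one bound serves all approximations.\<close>

lemma harnack_bound:
  assumes "simple_graph V E" "locally_finite_graph V E" "x0 \<in> V" "(graph_adj E)\<^sup>*\<^sup>* x0 y"
  shows "\<exists>P C. finite P \<and> P \<subseteq> V \<and> C \<ge> 0 \<and>
    (\<forall>w a. a \<ge> m \<longrightarrow> (\<forall>x\<in>V. w x \<ge> 0) \<longrightarrow> w x0 = 1 \<longrightarrow> (\<forall>x\<in>P. laplacian E w x = a * w x)
      \<longrightarrow> w y \<le> C)"
  using assms(4)
proof induction
  case base
  show ?case by (intro exI[of _ "{}"] exI[of _ 1]) auto
next
  case (step y z)
  obtain P C where P: "finite P" "P \<subseteq> V" "C \<ge> 0"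
    "\<forall>w a. a \<ge> m \<longrightarrow> (\<forall>x\<in>V. w x \<ge> 0) \<longrightarrow> w x0 = 1 \<longrightarrow> (\<forall>x\<in>P. laplacian E w x = a * w x)
      \<longrightarrow> w y \<le> C"
    using step(3) by (elim exE conjE) (rule that)
  have yz: "y \<in> V" "z \<in> V" using graph_adj_V[OF assms(1) step(2)] by auto
  let ?d = "real (card {u. graph_adj E y u})"
  have "w z \<le> \<bar>?d - m\<bar> * C" if w: "a \<ge> m" "\<forall>x\<in>V. w x \<ge> 0" "w x0 = 1"
    "\<forall>x\<in>insert y P. laplacian E w x = a * w x" for w a
  proof -
    have "w z \<le> (\<Sum>u | graph_adj E y u. w u)"
      using step(2) w(2) graph_adj_V[OF assms(1)] locally_finite_nbrs[OF assms(1,2)]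
      by (intro member_le_sum) auto
    also have "\<dots> = (?d - a) * w y"
      using w(4) by (simp add: laplacian_eq_degree algebra_simps)
    \<comment> \<open>The absolute value keeps the factor nonnegative, as the next step needs, even
      if \<open>m\<close> exceeds the degree.\<close>
    also have "\<dots> \<le> \<bar>?d - m\<bar> * w y"
      using w(1,2) yz by (intro mult_right_mono) auto
    also have "\<dots> \<le> \<bar>?d - m\<bar> * C"
      using P(4)[THEN spec, THEN spec, THEN mp, OF w(1)] w(2-4) by (intro mult_left_mono) simp_all
    finally show ?thesis .
  qed
  then show ?case
    using P(1-3) yz by (intro exI[of _ "insert y P"] exI[of _ "\<bar>?d - m\<bar> * C"]) auto
qed

lemma ex_positive_harmonic:
  assumes "simple_graph V E" "infinite V" "locally_finite_graph V E" "connected_graph V E"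
    and "x0 \<in> V" "c \<le> lambda0 V E x0"
  shows "\<exists>v. harmonic_fn V E c v \<and> (\<forall>x\<in>V. v x > 0)"
proof -
  \<comment> \<open>The lower bound \<open>c - 1\<close> covers every parameter
    \<open>c - \<epsilon>\<close> with \<open>\<epsilon> \<le> 1\<close>.\<close>
  define H where "H y P C \<longleftrightarrow> finite P \<and> P \<subseteq> V \<and> C \<ge> 0 \<and>
    (\<forall>w a. a \<ge> c - 1 \<longrightarrow> (\<forall>x\<in>V. w x \<ge> 0) \<longrightarrow> w x0 = 1 \<longrightarrow> (\<forall>x\<in>P. laplacian E w x = a * w x)
      \<longrightarrow> w y \<le> C)" for y P C
  have "\<exists>P C. H y P C" if "y \<in> V" for y
    unfolding H_def
    by (rule harnack_bound[OF assms(1,3,5)]) (use that assms(4,5) in \<open>auto simp: connected_graph_def\<close>)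
  then obtain P C where H: "\<And>y. y \<in> V \<Longrightarrow> H y (P y) (C y)" by metis
  have P: "\<And>y. y \<in> V \<Longrightarrow> finite (P y)" "\<And>y. y \<in> V \<Longrightarrow> P y \<subseteq> V"
    and C: "\<And>y. y \<in> V \<Longrightarrow> C y \<ge> 0"
    using H by (simp_all add: H_def)
  \<comment> \<open>Fixing the value 1 at \<open>x0\<close> prevents the limit from vanishing; the
    value 0 outside \<open>V\<close> keeps the product over the whole type compact.\<close>
  define J where "J x = (if x = x0 then {1} else if x \<in> V then {0..C x} else {0})" for x
  define K where "K = PiE UNIV J"
  \<comment> \<open>For \<open>p = (x, n)\<close>: the equation at \<open>x\<close> up to relative
    error \<open>1 / (n + 1)\<close>. It is a closed condition, and exact once imposed for all
    \<open>n\<close>.\<close>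
  define A where "A p = {w. \<bar>laplacian E w (fst p) - c * w (fst p)\<bar> \<le> w (fst p) / (real (snd p) + 1)}"
    for p :: "'a \<times> nat"
  have "compactin euclidean K"
    unfolding K_def euclidean_product_topology[symmetric] compactin_PiE by (auto simp: J_def)
  then have "compact K" by simp
  then have "K \<inter> \<Inter> (A ` (V \<times> UNIV)) \<noteq> {}"
  proof (rule compact_imp_fip_image)
    show "closed (A p)" for p
      unfolding A_def laplacian_def
      by (intro closed_Collect_le continuous_intros continuous_on_product_coordinates) auto
    fix I assume I: "finite I" "I \<subseteq> V \<times> (UNIV :: nat set)"
    \<comment> \<open>The finest precision demanded by \<open>I\<close> determines
      \<open>\<epsilon>\<close>.\<close>
    obtain n where n: "\<And>p. p \<in> I \<Longrightarrow> snd p \<le> n"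
      using finite_nat_set_iff_bounded_le[of "snd ` I"] I(1) by auto
    define \<epsilon> where "\<epsilon> = 1 / (real n + 1)"
    have \<epsilon>: "\<epsilon> > 0" "\<epsilon> \<le> 1" by (auto simp: \<epsilon>_def field_simps)
    \<comment> \<open>\<open>Z\<close> holds \<open>x0\<close> and every vertex whose value enters a
      condition from \<open>I\<close>; \<open>U\<close> then adds the sets where the Harnack bounds
      on \<open>Z\<close> require the equation.\<close>
    define Z where "Z = insert x0 (fst ` I \<union> (\<Union>x\<in>fst ` I. {y. graph_adj E x y}))"
    have Z: "finite Z" "Z \<subseteq> V"
      using I locally_finite_nbrs[OF assms(1,3)] graph_adj_V[OF assms(1)] assms(5)
      by (auto simp: Z_def)
    define U where "U = Z \<union> (\<Union>z\<in>Z. P z)"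
    have U: "finite U" "U \<subseteq> V" unfolding U_def using Z P by blast+
    obtain w where w: "\<forall>x\<in>V. w x > 0" "w x0 = 1" "\<forall>x\<in>U. laplacian E w x = (c - \<epsilon>) * w x"
      using positive_solution_on_finite[OF assms(1-5) U, of "c - \<epsilon>"] \<epsilon> assms(6) by auto
    have wC: "w z \<le> C z" if "z \<in> Z" for z
    proof -
      have "H z (P z) (C z)" using H that Z(2) by blast
      moreover have "c - \<epsilon> \<ge> c - 1" using \<epsilon> by simp
      moreover have "\<forall>x\<in>V. w x \<ge> 0" using w(1) by (simp add: less_imp_le)
      moreover have "\<forall>x\<in>P z. laplacian E w x = (c - \<epsilon>) * w x" using w(3) that by (auto simp: U_def)
      ultimately show ?thesis using w(2) unfolding H_def by blast
    qed
    \<comment> \<open>The Harnack bounds are only available on \<open>Z\<close>, hence the truncation.\<close>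
    define u where "u x = (if x \<in> Z then w x else 0)" for x
    have "u x \<in> J x" for x
    proof -
      have "x0 \<in> Z" by (simp add: Z_def)
      moreover have "0 \<le> w x" if "x \<in> V" using w(1) that by (simp add: less_imp_le)
      ultimately show ?thesis
        using w(2) wC[of x] C[of x] Z(2) by (auto simp: J_def u_def)
    qed
    then have "u \<in> K" by (auto simp: K_def)
    moreover have "u \<in> A p" if p: "p \<in> I" for p
    proof -
      have x: "fst p \<in> Z" "\<And>y. graph_adj E (fst p) y \<Longrightarrow> y \<in> Z" using p by (auto simp: Z_def)
      have "laplacian E u (fst p) = laplacian E w (fst p)"
        unfolding laplacian_def u_def using x by (intro sum.cong) auto
      also have "\<dots> = (c - \<epsilon>) * w (fst p)" using w(3) x by (auto simp: U_def)
      finally have "laplacian E u (fst p) - c * u (fst p) = - (\<epsilon> * w (fst p))"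
        using x by (simp add: u_def algebra_simps)
      moreover have pos: "w (fst p) > 0" using w(1) x Z by auto
      moreover have "\<epsilon> * w (fst p) \<le> w (fst p) / (real (snd p) + 1)"
        unfolding \<epsilon>_def using n[OF p] pos by (simp add: frac_le)
      ultimately show ?thesis using x \<epsilon> by (simp add: A_def u_def)
    qed
    ultimately show "K \<inter> \<Inter> (A ` I) \<noteq> {}" by blast
  qed
  then obtain w where wK: "w \<in> K" and wA: "\<And>x n. x \<in> V \<Longrightarrow> w \<in> A (x, n)" by blast
  have wJ: "w x \<in> J x" for x using wK by (auto simp: K_def)
  have w0: "w x0 = 1" using wJ[of x0] by (simp add: J_def)
  have w_nonneg: "w x \<ge> 0" for x using wJ[of x] by (auto simp: J_def split: if_splits)
  have harm: "laplacian E w x = c * w x" if "x \<in> V" for x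
  proof -
    have "(\<lambda>n. w x * inverse (real (Suc n))) \<longlonglongrightarrow> w x * 0"
      by (intro tendsto_mult_left LIMSEQ_inverse_real_of_nat)
    moreover have "\<bar>laplacian E w x - c * w x\<bar> \<le> w x * inverse (real (Suc n))" for n
      using wA[OF that, of n] by (simp add: A_def divide_inverse add.commute)
    ultimately have "\<bar>laplacian E w x - c * w x\<bar> \<le> w x * 0"
      by (intro LIMSEQ_le_const) auto
    then show ?thesis by simp
  qed
  have "w b > 0" if "b \<in> V" for b
    by (rule positive_if_nonneg_harmonic[OF assms(1,3,4) _ _ assms(5) _ that])
      (simp_all add: w_nonneg harm w0)
  then show ?thesis using harm by (auto simp: harmonic_fn_def)
qed

theorem theorem4p1p2:
  fixes V :: "'a set" and E :: "'a set set" and x0 :: 'a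
  assumes "simple_graph V E"
    and "infinite V"
    and "locally_finite_graph V E"
    and "connected_graph V E"
    and "x0 \<in> V"
  shows "(\<forall>c::real. c \<le> lambda0 V E x0 \<longrightarrow>
            (\<exists>v. harmonic_fn V E c v \<and> (\<forall>x\<in>V. v x > 0))) \<and>
         (\<forall>c::real. c > lambda0 V E x0 \<longrightarrow>
            \<not> (\<exists>v. harmonic_fn V E c v \<and> (\<forall>x\<in>V. v x > 0)))"
  using ex_positive_harmonic[OF assms] le_lambda0_of_positive_harmonic[OF assms(1,3-5)]
  by (meson not_le)

end
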